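(* Let $\rho>0$ and let $(\eta^{(L,N)}(t))_{t\ge0}$ be the inclusion process generated by $\mathfrak L_{L,N}$, with rates satisfying the assumptions in the context. If it is started from $\overline\eta=\overline\eta^{(L,N)}\in\Omega_{L,N}$ such that the limit $\lim_{N/L\to\rho}\gamma_N(\overline\eta)\in[0,1]$ exists, then for every $T\in(0,\infty)$ $$\lim_{N/L\to\rho}\int_0^T\frac{\#_{>A}\eta^{(L,N)}(t)}{L}\,dt=0\qquad\text{in }\mathbf P\text{-probability}.$$
   Context: $\lim_{N/L\to\rho}$ denotes the thermodynamic limit $N,L\to\infty$ with $N/L\to\rho$. Inclusion process. For $L,N\in\mathbb N$ let $\Omega_{L,N}=\{\eta\in\mathbb N_0^L:\sum_{i=1}^L\eta_i=N\}$, and let $\eta^{i,j}=\eta-e_i+e_j$ be the configuration after one particle jumps from $i$ to $j$. The generator is $$\mathfrak L_{L,N}f(\eta)=\sum_{i,j=1}^L u_1(\eta_i)\,u_2(\eta_j)\,[f(\eta^{i,j})-f(\eta)],$$ with rates $u_1=u_{1,L}$, $u_2=u_{2,L}:\mathbb N_0\to[0,\infty)$, $u_1(0)=0$. Assumptions on rates: there are $A\in\mathbb N_0$ and $\zeta_L=\mathcal O(1/L)$ such that (a) (slow phase) there are constants $q_k$ ($1\le k\le A$) and $r_k$ ($0\le k\le A$), independent of $L$, with $r_k\ge q_k>0$ for $1\le k\le A$ and $r_0>0$, such that $|u_1(k)L-q_k|\le\zeta_L$ for $k=1,\dots,A$ and $|u_2(k)L-r_k|\le\zeta_L$ for $k=0,\dots,A$;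 set $q_0:=0$; (b) (fast phase) $\sup_{n>A}|u_\iota(n)-(n-A)|\le\zeta_L$ for $\iota=1,2$. Further notation: $\eta_i^+:=\max\{\eta_i-A,0\}$, $\gamma_N(\eta):=\sum_{i=1}^L\eta_i^+/N$ (relative mass in the fast phase), $\#_{>A}\eta:=\sum_{i=1}^L\mathbf 1_{\eta_i>A}$. *)

theory Defs
  imports "HOL-Probability.Probability" "HOL-Library.Landau_Symbols"
begin

(* A configuration is a function that vanishes off the sites {1..L}, so that for each
   L and N there are only finitely many of them. *)
type_synonym config = "nat \<Rightarrow> nat"

definition Omega :: "nat \<Rightarrow> nat \<Rightarrow> config set" where
  "Omega L N = {\<eta>. (\<forall>i. i \<notin> {1..L} \<longrightarrow> \<eta> i = 0) \<and> (\<Sum>i=1..L. \<eta> i) = N}"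

(* \<eta> - e_i + e_j. The truncated subtraction is used only if \<eta> i = 0, where the jump rate
   vanishes because u1 0 = 0; for i = j and \<eta> i > 0 the result is \<eta>. *)
definition jump :: "nat \<Rightarrow> nat \<Rightarrow> config \<Rightarrow> config" where
  "jump i j \<eta> = (\<eta>(i := \<eta> i - 1))(j := (\<eta>(i := \<eta> i - 1)) j + 1)"

definition generator ::
  "nat \<Rightarrow> (nat \<Rightarrow> real) \<Rightarrow> (nat \<Rightarrow> real) \<Rightarrow> (config \<Rightarrow> real) \<Rightarrow> config \<Rightarrow> real" where
  "generator L u1 u2 f \<eta> =
     (\<Sum>i=1..L. \<Sum>j=1..L. u1 (\<eta> i) * u2 (\<eta> j) * (f (jump i j \<eta>) - f \<eta>))"

(* The semigroup exp (t G) of an operator G on functions. For the generator above the series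
   converges absolutely at every \<eta> in Omega L N: G f restricted to this finite set depends
   only on the restriction of f to it. *)
definition semigroup_of ::
  "((config \<Rightarrow> real) \<Rightarrow> config \<Rightarrow> real) \<Rightarrow> real \<Rightarrow> (config \<Rightarrow> real) \<Rightarrow> config \<Rightarrow> real" where
  "semigroup_of G t f \<eta> = (\<Sum>n. t ^ n / fact n * (G ^^ n) f \<eta>)"

definition trans_prob ::
  "((config \<Rightarrow> real) \<Rightarrow> config \<Rightarrow> real) \<Rightarrow> real \<Rightarrow> config \<Rightarrow> config \<Rightarrow> real" where
  "trans_prob G t \<eta> \<xi> = semigroup_of G t (indicator {\<xi>}) \<eta>"

(* Right-continuity with left limits, for paths in a discrete space. *)
definition cadlag_discrete :: "(real \<Rightarrow> 'c) \<Rightarrow> bool" where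
  "cadlag_discrete x \<longleftrightarrow>
     (\<forall>t\<ge>0. eventually (\<lambda>s. x s = x t) (at_right t)) \<and>
     (\<forall>t>0. \<exists>c. eventually (\<lambda>s. x s = c) (at_left t))"

(* The continuous-time Markov chain on the finite set S with generator G, started from x0:
   paths are right-continuous with left limits, X 0 = x0 almost surely (the case n = 0 with
   x 0 = x0 in the last conjunct), and the transition probabilities are those of exp (t G). *)
definition markov_process_started ::
  "'a measure \<Rightarrow> config set \<Rightarrow> ((config \<Rightarrow> real) \<Rightarrow> config \<Rightarrow> real) \<Rightarrow> config
     \<Rightarrow> (real \<Rightarrow> 'a \<Rightarrow> config) \<Rightarrow> bool" where
  "markov_process_started M S G x0 X \<longleftrightarrow>
     prob_space M \<and>
     (\<forall>t\<ge>0. X t \<in> measurable M (count_space S)) \<and>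
     (\<forall>\<omega>\<in>space M. cadlag_discrete (\<lambda>t. X t \<omega>)) \<and>
     (\<forall>n (t :: nat \<Rightarrow> real) (x :: nat \<Rightarrow> config).
        t 0 = 0 \<and> (\<forall>i<n. t i \<le> t (Suc i)) \<and> x 0 = x0 \<and> (\<forall>i\<le>n. x i \<in> S) \<longrightarrow>
        measure M {\<omega> \<in> space M. \<forall>i\<le>n. X (t i) \<omega> = x i} =
          (\<Prod>i<n. trans_prob G (t (Suc i) - t i) (x i) (x (Suc i))))"

(* For each L, u1 L and u2 L are the rate functions of the system on L sites. The last
   conjunct is the bound sup_{n>A} |u L n - (n - A)| \<le> \<zeta> L, for u1 and u2. *)
definition rate_assumptions ::
  "(nat \<Rightarrow> nat \<Rightarrow> real) \<Rightarrow> (nat \<Rightarrow> nat \<Rightarrow> real) \<Rightarrow> nat \<Rightarrow> (nat \<Rightarrow> real) \<Rightarrow> (nat \<Rightarrow> real)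
     \<Rightarrow> (nat \<Rightarrow> real) \<Rightarrow> bool" where
  "rate_assumptions u1 u2 A q r \<zeta> \<longleftrightarrow>
     (\<forall>L\<ge>1. \<forall>k. 0 \<le> u1 L k \<and> 0 \<le> u2 L k) \<and>
     (\<forall>L\<ge>1. u1 L 0 = 0) \<and>
     \<zeta> \<in> O(\<lambda>L. 1 / real L) \<and>
     q 0 = 0 \<and> r 0 > 0 \<and>
     (\<forall>k\<in>{1..A}. r k \<ge> q k \<and> q k > 0) \<and>
     (\<forall>L\<ge>1. \<forall>k\<in>{1..A}. \<bar>u1 L k * real L - q k\<bar> \<le> \<zeta> L) \<and>
     (\<forall>L\<ge>1. \<forall>k\<in>{0..A}. \<bar>u2 L k * real L - r k\<bar> \<le> \<zeta> L) \<and>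
     (\<forall>L\<ge>1. \<forall>n>A. \<bar>u1 L n - (real n - real A)\<bar> \<le> \<zeta> L \<and> \<bar>u2 L n - (real n - real A)\<bar> \<le> \<zeta> L)"

definition fast_mass :: "nat \<Rightarrow> nat \<Rightarrow> nat \<Rightarrow> config \<Rightarrow> real" where
  "fast_mass A L N \<eta> = (\<Sum>i=1..L. max (real (\<eta> i) - real A) 0 / real N)"

definition num_fast :: "nat \<Rightarrow> nat \<Rightarrow> config \<Rightarrow> nat" where
  "num_fast A L \<eta> = (\<Sum>i=1..L. of_bool (\<eta> i > A))"

(* L, N \<rightarrow> \<infinity> with N / L \<rightarrow> \<rho>, as a filter on the pairs (L, N): a limit along it is the
   common limit along all sequences (L_n, N_n) of this kind. *)
definition thermodynamic :: "real \<Rightarrow> (nat \<times> nat) filter" where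
  "thermodynamic \<rho> =
     inf (at_top \<times>\<^sub>F at_top) (filtercomap (\<lambda>(L, N). real N / real L) (nhds \<rho>))"

(* The random variables may live on different probability spaces. Their measurability is part
   of the definition because measure is 0 on non-measurable sets. *)
definition tendsto_in_prob ::
  "('i \<Rightarrow> 'a measure) \<Rightarrow> ('i \<Rightarrow> 'a \<Rightarrow> real) \<Rightarrow> real \<Rightarrow> 'i filter \<Rightarrow> bool" where
  "tendsto_in_prob M Y c F \<longleftrightarrow>
     eventually (\<lambda>i. Y i \<in> borel_measurable (M i)) F \<and>
     (\<forall>\<epsilon>>0. ((\<lambda>i. measure (M i) {\<omega> \<in> space (M i). \<bar>Y i \<omega> - c\<bar> > \<epsilon>}) \<longlongrightarrow> 0) F)"

end

theory Submission
  imports Defs "HOL-Analysis.Harmonic_Numbers" "HOL-Real_Asymp.Real_Asymp"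
begin

text \<open>
  Write \<open>n\<^sub>i\<close> for the excess of \<open>\<eta> i\<close> over \<open>A\<close>, \<open>M\<close> for the sum of the \<open>n\<^sub>i\<close> and \<open>K\<close>
  for the number of fast sites. Among the fast sites the rates are close to the symmetric product
  rates \<open>n\<^sub>i n\<^sub>j\<close>, so that the excess of a fast site performs a nearly unbiased walk, with
  steps at rate about \<open>n\<^sub>i (M - n\<^sub>i)\<close> in each direction. If \<open>M\<close> is small there are few
  fast sites anyway, as \<open>K \<le> M\<close>; if \<open>M\<close> is of order \<open>L\<close>, fast sites with few excess
  particles mostly die out within a time of order \<open>1 / L\<close>, and the excess concentrates. This is
  measured by the convex functional \<open>V \<eta> = (\<Sum>i. w (n\<^sub>i))\<close>, where \<open>w\<close> has increments \<open>w (n + 1) - w n = harm n\<close>;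
  \<open>w n\<close> behaves like \<open>n ln n\<close>. The second difference of \<open>w\<close> at \<open>n > 0\<close> is \<open>1 / n\<close>, which is
  exactly what cancels one factor in \<open>n\<^sub>i n\<^sub>j\<close>: after symmetrisation the jumps between
  different fast sites contribute \<open>(K - 1) M\<close> to the drift of \<open>V\<close>, and this is at least
  \<open>K\<^sup>2 - N\<close>, because every fast site has an excess of at least one and \<open>M \<le> N\<close>.

  Everything else is of lower order. Since \<open>harm 0 = 0\<close>, a jump onto a site that is not fast leaves
  the contribution of that site unchanged, even if it turns the site into a fast one. A jump
  from a slow site can only increase \<open>V\<close>. Jumps from fast to slow sites, and the
  deviations of the rates from the product form, occur at total rate \<open>O(L)\<close> and change \<open>V\<close> by at
  most \<open>harm N\<close>. Hence the drift of \<open>V\<close> is at least \<open>K\<^sup>2 - O(L ln L)\<close>, uniformly over all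
  configurations (\<open>generator_fast_entropy_ge\<close>).

  As \<open>V\<close> takes values between \<open>0\<close> and \<open>N harm N = O(L ln L)\<close>, Dynkin's formula shows that the
  expectation of the time integral of \<open>K\<^sup>2\<close> is \<open>O(L ln L)\<close>. The proof uses this in the linearised
  form \<open>K / L \<le> a + (K / L)\<^sup>2 / (4 a)\<close>, valid for every \<open>a > 0\<close>. Fubini's theorem and Markov's
  inequality (\<open>occupation_time_bound\<close>) then bound the probability that the
  occupation integral of \<open>K / L\<close> exceeds \<open>\<delta>\<close> by
  \<open>(a T + O(ln L / (a L))) / \<delta>\<close>, which vanishes for \<open>a = L powr (-1/4)\<close>.
\<close>

section \<open>Semigroups of bounded operators on a finite set\<close>

text \<open>
  The generator acts on functions of all configurations, but only its action on the finite invariant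
  set \<open>S\<close> is controlled. The bound says that the operator norm on \<open>S\<close> is at most \<open>C\<close>;
  with \<open>b = 0\<close> it also says that \<open>G f\<close> on \<open>S\<close> depends only on \<open>f\<close> on \<open>S\<close>.
\<close>

locale bounded_operator_on =
  fixes S :: "config set" and G :: "(config \<Rightarrow> real) \<Rightarrow> config \<Rightarrow> real" and C :: real
  assumes finite_S: "finite S"
    and add: "G (\<lambda>x. f x + g x) = (\<lambda>x. G f x + G g x)"
    and scale: "G (\<lambda>x. c * f x) = (\<lambda>x. c * G f x)"
    and bound: "(\<And>x. x \<in> S \<Longrightarrow> \<bar>f x\<bar> \<le> b) \<Longrightarrow> x \<in> S \<Longrightarrow> \<bar>G f x\<bar> \<le> C * b"
begin

lemma pow_add: "(G ^^ n) (\<lambda>x. f x + g x) = (\<lambda>x. (G ^^ n) f x + (G ^^ n) g x)"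
  by (induction n) (simp_all add: add)

lemma pow_scale: "(G ^^ n) (\<lambda>x. c * f x) = (\<lambda>x. c * (G ^^ n) f x)"
  by (induction n) (simp_all add: scale)

lemma pow_bound:
  assumes "\<And>x. x \<in> S \<Longrightarrow> \<bar>f x\<bar> \<le> b" "x \<in> S"
  shows "\<bar>(G ^^ n) f x\<bar> \<le> C ^ n * b"
  using assms(2)
proof (induction n arbitrary: x)
  case (Suc n)
  show ?case
    using bound[of "(G ^^ n) f" "C ^ n * b" x] Suc by (simp add: mult.assoc)
qed (use assms in simp)

lemma pow_cong:
  assumes "\<And>x. x \<in> S \<Longrightarrow> f x = g x" "x \<in> S"
  shows "(G ^^ n) f x = (G ^^ n) g x"
proof -
  have "\<bar>(G ^^ n) (\<lambda>x. f x + (-1) * g x) x\<bar> \<le> C ^ n * 0"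
    by (rule pow_bound) (use assms in auto)
  then show ?thesis
    by (simp only: pow_add pow_scale)
qed

lemma exists_bound: "\<exists>b. \<forall>x\<in>S. \<bar>f x\<bar> \<le> (b::real)"
  using finite_S by (intro exI[of _ "\<Sum>x\<in>S. \<bar>f x\<bar>"]) (auto intro: member_le_sum)

lemma summable_semigroup:
  assumes "x \<in> S"
  shows "summable (\<lambda>n. (G ^^ n) f x / fact n * t ^ n)"
proof -
  obtain b where b: "\<And>x. x \<in> S \<Longrightarrow> \<bar>f x\<bar> \<le> b" using exists_bound by blast
  have "summable (\<lambda>n. inverse (fact n) * (\<bar>C\<bar> * \<bar>t\<bar>) ^ n * b)"
    by (intro summable_mult2 summable_exp)
  moreover have "norm ((G ^^ n) f x / fact n * t ^ n)
      \<le> inverse (fact n) * (\<bar>C\<bar> * \<bar>t\<bar>) ^ n * b" for n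
  proof -
    have "\<bar>(G ^^ n) f x\<bar> \<le> C ^ n * b" by (rule pow_bound[OF b assms])
    also have "\<dots> \<le> \<bar>C\<bar> ^ n * b"
      using b[OF assms] by (intro mult_right_mono) (auto simp flip: power_abs)
    finally have "\<bar>(G ^^ n) f x\<bar> * (\<bar>t\<bar> ^ n / fact n) \<le> \<bar>C\<bar> ^ n * b * (\<bar>t\<bar> ^ n / fact n)"
      by (rule mult_right_mono) simp
    then show ?thesis
      by (simp add: abs_mult power_abs power_mult_distrib field_simps)
  qed
  ultimately show ?thesis by (rule summable_comparison_test'[where N=0])
qed

lemma semigroup_of_alt: "semigroup_of G t f x = (\<Sum>n. (G ^^ n) f x / fact n * t ^ n)"
  by (simp add: semigroup_of_def mult.commute)

lemma semigroup_add:
  assumes "x \<in> S"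
  shows "semigroup_of G t (\<lambda>x. f x + g x) x = semigroup_of G t f x + semigroup_of G t g x"
  unfolding semigroup_of_alt pow_add
  using suminf_add[OF summable_semigroup[OF assms, of f t] summable_semigroup[OF assms, of g t]]
  by (simp add: algebra_simps add_divide_distrib)

lemma semigroup_scale:
  assumes "x \<in> S"
  shows "semigroup_of G t (\<lambda>x. c * f x) x = c * semigroup_of G t f x"
  unfolding semigroup_of_alt pow_scale
  using suminf_mult[OF summable_semigroup[OF assms, of f t], of c]
  by (simp add: algebra_simps)

lemma semigroup_cong:
  assumes "\<And>x. x \<in> S \<Longrightarrow> f x = g x" "x \<in> S"
  shows "semigroup_of G t f x = semigroup_of G t g x"
  unfolding semigroup_of_def by (simp add: pow_cong[OF assms])

lemma semigroup_sum:
  assumes "x \<in> S" "finite B"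
  shows "semigroup_of G t (\<lambda>x. \<Sum>y\<in>B. c y * f y x) x = (\<Sum>y\<in>B. c y * semigroup_of G t (f y) x)"
  using assms(2)
proof induction
  case empty
  show ?case using semigroup_scale[OF assms(1), of t 0 "\<lambda>_. 0"] by simp
qed (simp add: semigroup_add semigroup_scale assms(1))

lemma semigroup_eq_sum_trans_prob:
  assumes "x \<in> S"
  shows "semigroup_of G t f x = (\<Sum>y\<in>S. f y * trans_prob G t x y)"
proof -
  have "semigroup_of G t f x = semigroup_of G t (\<lambda>z. \<Sum>y\<in>S. f y * indicator {y} z) x"
    by (rule semigroup_cong)
      (use assms finite_S in \<open>auto simp: indicator_def if_distrib cong: if_cong\<close>)
  also have "\<dots> = (\<Sum>y\<in>S. f y * trans_prob G t x y)"
    unfolding trans_prob_def by (rule semigroup_sum[OF assms finite_S])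
  finally show ?thesis .
qed

text \<open>
  Differentiating the exponential series termwise shifts the coefficients by one power of \<open>G\<close>.
  This is Kolmogorov's forward equation; taking expectations turns its integrated form into
  Dynkin's formula.
\<close>

lemma semigroup_deriv:
  assumes "x \<in> S"
  shows "((\<lambda>t. semigroup_of G t f x) has_real_derivative semigroup_of G t (G f) x) (at t)"
proof -
  have "diffs (\<lambda>n. (G ^^ n) f x / fact n) n = (G ^^ n) (G f) x / fact n" for n
    by (simp add: diffs_def funpow_swap1 field_simps del: of_nat_Suc)
  then show ?thesis
    unfolding semigroup_of_alt
    using termdiffs_strong_converges_everywhere[of "\<lambda>n. (G ^^ n) f x / fact n" t]
      summable_semigroup[OF assms, of f]
    by simp
qed

lemma has_integral_semigroup:
  assumes "x \<in> S" "0 \<le> T"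
  shows "((\<lambda>t. semigroup_of G t (G f) x) has_integral (semigroup_of G T f x - f x)) {0..T}"
proof -
  have "semigroup_of G 0 f x = f x"
    unfolding semigroup_of_alt using powser_zero[of "\<lambda>n. (G ^^ n) f x / fact n"] by simp
  then show ?thesis
    using fundamental_theorem_of_calculus[of 0 T "\<lambda>t. semigroup_of G t f x"
        "\<lambda>t. semigroup_of G t (G f) x"] assms semigroup_deriv[OF assms(1), of f]
    by (auto simp: has_real_derivative_iff_has_vector_derivative[symmetric]
        intro: has_field_derivative_at_within)
qed

lemma continuous_on_semigroup:
  assumes "x \<in> S"
  shows "continuous_on U (\<lambda>t. semigroup_of G t f x)"
  using semigroup_deriv[OF assms, of f]
  by (intro continuous_at_imp_continuous_on) (blast intro: DERIV_isCont)

end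

text \<open>
  The finite-dimensional distributions at the times \<open>0\<close> and \<open>t\<close> give the probability of
  \<open>X 0 = x0\<close> and \<open>X t = y\<close> jointly; the first condition holds almost surely.
\<close>

lemma marginal_eq_trans_prob:
  assumes mp: "markov_process_started M S G x0 X" and "x0 \<in> S" "y \<in> S" "0 \<le> t"
  shows "measure M {\<omega> \<in> space M. X t \<omega> = y} = trans_prob G t x0 y"
proof -
  interpret prob_space M using mp by (simp add: markov_process_started_def)
  have meas: "{\<omega> \<in> space M. X s \<omega> = z} \<in> sets M" if "0 \<le> s" "z \<in> S" for s z
  proof -
    have "X s -` {z} \<inter> space M \<in> sets M"
      using mp that by (intro measurable_sets[of _ M "count_space S"])
        (auto simp: markov_process_started_def)
    then show ?thesis by (simp add: vimage_def Int_def conj_commute)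
  qed
  have fd: "measure M {\<omega> \<in> space M. \<forall>i\<le>n. X (t i) \<omega> = x i} =
      (\<Prod>i<n. trans_prob G (t (Suc i) - t i) (x i) (x (Suc i)))"
    if "t 0 = 0" "\<forall>i<n. t i \<le> t (Suc i)" "x 0 = x0" "\<forall>i\<le>n. x i \<in> S" for n t x
    using mp that unfolding markov_process_started_def by blast
  have "measure M {\<omega> \<in> space M. X 0 \<omega> = x0} = 1"
    using fd[of "\<lambda>_. 0" 0 "\<lambda>_. x0"] assms by simp
  then have ae: "AE \<omega> in M. X 0 \<omega> = x0"
    using prob_eq_1[OF meas[of 0 x0]] assms(2) by auto
  have "measure M {\<omega> \<in> space M. X t \<omega> = y} = measure M {\<omega> \<in> space M. X 0 \<omega> = x0 \<and> X t \<omega> = y}"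
  proof (rule finite_measure_eq_AE)
    show "AE \<omega> in M. (\<omega> \<in> {\<omega> \<in> space M. X t \<omega> = y}) = (\<omega> \<in> {\<omega> \<in> space M. X 0 \<omega> = x0 \<and> X t \<omega> = y})"
      using ae by eventually_elim auto
    show "{\<omega> \<in> space M. X t \<omega> = y} \<in> sets M" using meas assms by simp
    have "{\<omega> \<in> space M. X 0 \<omega> = x0 \<and> X t \<omega> = y}
        = {\<omega> \<in> space M. X 0 \<omega> = x0} \<inter> {\<omega> \<in> space M. X t \<omega> = y}" by auto
    then show "{\<omega> \<in> space M. X 0 \<omega> = x0 \<and> X t \<omega> = y} \<in> sets M" using meas assms by simp
  qed
  also have "\<dots> = trans_prob G t x0 y"
  proof -
    have all1: "(\<forall>i\<le>1. P i) \<longleftrightarrow> P 0 \<and> P 1" for P :: "nat \<Rightarrow> bool"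
      by (auto simp: le_Suc_eq)
    show ?thesis
      using fd[of "\<lambda>i. if i = 0 then 0 else t" 1 "\<lambda>i. if i = 0 then x0 else y"] assms
      unfolding all1 by simp
  qed
  finally show ?thesis .
qed

lemma (in bounded_operator_on) expectation_eq_semigroup:
  assumes mp: "markov_process_started M S G x0 X" and x0: "x0 \<in> S" and t: "0 \<le> t"
  shows "integral\<^sup>L M (\<lambda>\<omega>. f (X t \<omega>)) = semigroup_of G t f x0"
    and "integrable M (\<lambda>\<omega>. f (X t \<omega>))"
proof -
  interpret prob_space M using mp by (simp add: markov_process_started_def)
  have X: "X t \<in> measurable M (count_space S)"
    using mp t by (simp add: markov_process_started_def)
  have sets: "{\<omega> \<in> space M. X t \<omega> = y} \<in> sets M" if "y \<in> S" for y
    using measurable_sets[OF X, of "{y}"] that by (simp add: vimage_def Int_def conj_commute)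
  have eq: "f (X t \<omega>) = (\<Sum>y\<in>S. f y * indicator {\<omega> \<in> space M. X t \<omega> = y} \<omega>)"
    if "\<omega> \<in> space M" for \<omega>
    using that finite_S measurable_space[OF X that]
    by (auto simp: indicator_def if_distrib cong: if_cong)
  have "integrable M (\<lambda>\<omega>. \<Sum>y\<in>S. f y * indicator {\<omega> \<in> space M. X t \<omega> = y} \<omega>)"
    by (intro Bochner_Integration.integrable_sum integrable_mult_right) (simp add: sets emeasure_eq_measure)
  then show "integrable M (\<lambda>\<omega>. f (X t \<omega>))"
    by (subst Bochner_Integration.integrable_cong[OF refl eq])
  have "integral\<^sup>L M (\<lambda>\<omega>. f (X t \<omega>))
      = integral\<^sup>L M (\<lambda>\<omega>. \<Sum>y\<in>S. f y * indicator {\<omega> \<in> space M. X t \<omega> = y} \<omega>)"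
    by (rule Bochner_Integration.integral_cong[OF refl eq])
  also have "\<dots> = (\<Sum>y\<in>S. f y * measure M {\<omega> \<in> space M. X t \<omega> = y})"
    by (subst Bochner_Integration.integral_sum)
      (auto intro!: sum.cong simp: sets emeasure_eq_measure Int_absorb2)
  also have "\<dots> = semigroup_of G t f x0"
    by (simp add: semigroup_eq_sum_trans_prob x0 marginal_eq_trans_prob[OF mp x0 _ t])
  finally show "integral\<^sup>L M (\<lambda>\<omega>. f (X t \<omega>)) = semigroup_of G t f x0" .
qed

text \<open>
  By right-continuity the path at time \<open>t\<close> is the limit of its values at the smallest point of
  \<open>(1 / (k + 1)) \<nat>\<close> that is strictly larger than \<open>t\<close>. Each approximation takes countably many
  times only, so that it is jointly measurable. Times are truncated at \<open>0\<close> because the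
  process lives on nonnegative times.
\<close>

lemma joint_measurable_path:
  assumes meas: "\<And>t. 0 \<le> t \<Longrightarrow> X t \<in> measurable M (count_space S)"
    and cadlag: "\<And>\<omega>. \<omega> \<in> space M \<Longrightarrow> cadlag_discrete (\<lambda>t. X t \<omega>)"
  shows "(\<lambda>(t, \<omega>). (f :: config \<Rightarrow> real) (X (max 0 t) \<omega>)) \<in> borel_measurable (lborel \<Otimes>\<^sub>M M)"
proof -
  define s where "s k i = (real i + 1) / real (Suc k)" for k i :: nat
  define g where "g k t = nat \<lfloor>real (Suc k) * max 0 t\<rfloor>" for k :: nat and t :: real
  have s_gt: "s k (g k t) > max 0 t" for k t
  proof -
    have "real (Suc k) * max 0 t < real (g k t) + 1"
      unfolding g_def by linarith
    then show ?thesis unfolding s_def by (subst pos_less_divide_eq) (simp_all add: mult.commute)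
  qed
  have s_le: "s k (g k t) \<le> max 0 t + 1 / real (Suc k)" for k t
  proof -
    have "real (g k t) \<le> real (Suc k) * max 0 t"
      unfolding g_def by (rule of_nat_floor) simp
    then show ?thesis unfolding s_def by (simp add: field_simps del: of_nat_Suc)
  qed
  have lim: "(\<lambda>k. s k (g k t)) \<longlonglongrightarrow> max 0 t" for t
  proof (rule tendsto_sandwich)
    show "(\<lambda>k. max 0 t) \<longlonglongrightarrow> max 0 t" by simp
    show "(\<lambda>k. max 0 t + 1 / real (Suc k)) \<longlonglongrightarrow> max 0 t"
      using tendsto_add[OF tendsto_const LIMSEQ_inverse_real_of_nat, of "max 0 t"]
      by (simp add: inverse_eq_divide)
  qed (intro always_eventually allI s_le less_imp_le[OF s_gt])+
  have pt: "(\<lambda>k. f (X (s k (g k t)) \<omega>)) \<longlonglongrightarrow> f (X (max 0 t) \<omega>)" if "\<omega> \<in> space M" for t \<omega>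
  proof (rule tendsto_eventually)
    have "filterlim (\<lambda>k. s k (g k t)) (at_right (max 0 t)) sequentially"
      using lim s_gt by (auto simp: filterlim_at less_imp_neq[THEN not_sym] intro!: always_eventually)
    moreover have "eventually (\<lambda>s. X s \<omega> = X (max 0 t) \<omega>) (at_right (max 0 t))"
      using cadlag[OF that] by (simp add: cadlag_discrete_def)
    ultimately have "eventually (\<lambda>k. X (s k (g k t)) \<omega> = X (max 0 t) \<omega>) sequentially"
      by (rule eventually_compose_filterlim[rotated])
    then show "eventually (\<lambda>k. f (X (s k (g k t)) \<omega>) = f (X (max 0 t) \<omega>)) sequentially"
      by eventually_elim simp
  qed
  have "(\<lambda>p. f (X (s k (g k (fst p))) (snd p))) \<in> borel_measurable (lborel \<Otimes>\<^sub>M M)" for k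
  proof (rule measurable_compose_countable)
    show "(\<lambda>p. f (X (s k i) (snd p))) \<in> borel_measurable (lborel \<Otimes>\<^sub>M M)" for i
    proof -
      have X: "X (s k i) \<in> measurable M (count_space S)"
        by (rule meas) (simp add: s_def)
      then have "(\<lambda>\<omega>. f (X (s k i) \<omega>)) \<in> borel_measurable M"
        by (rule measurable_compose) simp
      then show ?thesis by measurable
    qed
    show "(\<lambda>p. g k (fst p)) \<in> measurable (lborel \<Otimes>\<^sub>M M) (count_space UNIV)"
      unfolding g_def by measurable
  qed
  then have "(\<lambda>p. f (X (max 0 (fst p)) (snd p))) \<in> borel_measurable (lborel \<Otimes>\<^sub>M M)"
    by (rule borel_measurable_LIMSEQ_real[rotated]) (auto simp: space_pair_measure intro!: pt)
  then show ?thesis by (simp add: case_prod_beta')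
qed

text \<open>
  If \<open>f\<close> is dominated by the drift of a bounded functional \<open>V\<close> up to a constant, the time integral
  of \<open>f\<close> is controlled in mean: by Dynkin's formula the drift integrates to the expected increment of
  \<open>V\<close>, which is at most \<open>v\<close>. Markov's inequality turns this into a tail bound.
\<close>

lemma (in bounded_operator_on) occupation_time_bound:
  assumes mp: "markov_process_started M S G x0 X" and x0: "x0 \<in> S" and T: "0 \<le> T"
    and f: "\<And>x. x \<in> S \<Longrightarrow> 0 \<le> f x" "\<And>x. x \<in> S \<Longrightarrow> f x \<le> G V x + c"
    and V: "\<And>x. x \<in> S \<Longrightarrow> 0 \<le> V x" "\<And>x. x \<in> S \<Longrightarrow> V x \<le> v"
    and eps: "0 < \<epsilon>"
  defines "Y \<equiv> (\<lambda>\<omega>. LINT t:{0..T}|lborel. f (X t \<omega>))"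
  shows "Y \<in> borel_measurable M"
    and "measure M {\<omega> \<in> space M. \<bar>Y \<omega>\<bar> > \<epsilon>} \<le> (v + c * T) / \<epsilon>"
proof -
  interpret prob_space M using mp by (simp add: markov_process_started_def)
  interpret P: pair_sigma_finite lborel M ..
  have X: "X t \<in> measurable M (count_space S)" if "0 \<le> t" for t
    using mp that by (simp add: markov_process_started_def)
  have in_S: "X t \<omega> \<in> S" if "0 \<le> t" "\<omega> \<in> space M" for t \<omega>
    using measurable_space[OF X] that by simp
  (* X is measurable at nonnegative times only, so the integrand is extended constantly to
     negative times before the time interval is cut out. *)
  define F where "F t \<omega> = indicator {0..T} t * f (X (max 0 t) \<omega>)" for t \<omega>
  have Y_eq: "Y \<omega> = (\<integral>t. F t \<omega> \<partial>lborel)" for \<omega>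
    unfolding Y_def F_def set_lebesgue_integral_def
    by (rule Bochner_Integration.integral_cong) (auto simp: indicator_def)
  have "(\<lambda>(t, \<omega>). f (X (max 0 t) \<omega>)) \<in> borel_measurable (lborel \<Otimes>\<^sub>M M)"
    by (rule joint_measurable_path) (use mp in \<open>auto simp: markov_process_started_def\<close>)
  then have F_meas [measurable]: "(\<lambda>(t, \<omega>). F t \<omega>) \<in> borel_measurable (lborel \<Otimes>\<^sub>M M)"
    unfolding F_def by (simp add: case_prod_beta')
  have F_nonneg: "0 \<le> F t \<omega>" if "\<omega> \<in> space M" for t \<omega>
    using f(1)[OF in_S[of "max 0 t", OF _ that]] by (simp add: F_def)
  have F_int: "integrable M (F t)" and EF: "(\<integral>\<omega>. F t \<omega> \<partial>M) = indicator {0..T} t * semigroup_of G t f x0" for t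
    using expectation_eq_semigroup[OF mp x0, of "max 0 t" f]
    by (auto simp: F_def[abs_def] indicator_def)
  have cont: "set_integrable lborel {0..T} (\<lambda>t. semigroup_of G t f x0)"
    by (intro borel_integrable_atLeastAtMost' continuous_on_semigroup x0)
  have "integrable (lborel \<Otimes>\<^sub>M M) (\<lambda>(t, \<omega>). F t \<omega>)"
  proof (rule P.Fubini_integrable)
    have "(\<integral>\<omega>. norm (F t \<omega>) \<partial>M) = indicator {0..T} t * semigroup_of G t f x0" for t
      unfolding EF[symmetric] by (rule Bochner_Integration.integral_cong) (simp_all add: F_nonneg)
    then show "integrable lborel (\<lambda>t. \<integral>\<omega>. norm (case (t, \<omega>) of (t, \<omega>) \<Rightarrow> F t \<omega>) \<partial>M)"
      using cont by (simp add: set_integrable_def)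
  qed (use F_int F_meas in auto)
  note F_integrable = this
  have Y_int: "integrable M Y"
    using P.integrable_snd[OF F_integrable] by (simp add: Y_eq[abs_def])
  then show "Y \<in> borel_measurable M" by simp
  have "(\<integral>\<omega>. Y \<omega> \<partial>M) = (LINT t:{0..T}|lborel. semigroup_of G t f x0)"
    using P.Fubini_integral[OF F_integrable] by (simp add: Y_eq EF set_lebesgue_integral_def)
  also have "\<dots> = integral {0..T} (\<lambda>t. semigroup_of G t f x0)"
    by (rule set_borel_integral_eq_integral(2)[OF cont])
  also have "\<dots> \<le> (semigroup_of G T V x0 - V x0) + c * T"
  proof (rule has_integral_le)
    show "((\<lambda>t. semigroup_of G t f x0) has_integral integral {0..T} (\<lambda>t. semigroup_of G t f x0)) {0..T}"
      by (intro integrable_integral integrable_continuous_real continuous_on_semigroup x0)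
    show "((\<lambda>t. semigroup_of G t (G V) x0 + c) has_integral (semigroup_of G T V x0 - V x0 + c * T)) {0..T}"
      using has_integral_add[OF has_integral_semigroup[OF x0 T, of V] has_integral_const_real[of c 0 T]] T
      by (simp add: mult.commute)
    show "semigroup_of G t f x0 \<le> semigroup_of G t (G V) x0 + c" if t: "t \<in> {0..T}" for t
    proof -
      have "semigroup_of G t f x0 = (\<integral>\<omega>. f (X t \<omega>) \<partial>M)"
        using expectation_eq_semigroup(1)[OF mp x0, of t f] t by simp
      also have "\<dots> \<le> (\<integral>\<omega>. G V (X t \<omega>) + c \<partial>M)"
        using expectation_eq_semigroup(2)[OF mp x0, of t] t f(2) in_S
        by (intro integral_mono) auto
      also have "\<dots> = semigroup_of G t (G V) x0 + c"
        using expectation_eq_semigroup[OF mp x0, of t "G V"] t by (simp add: prob_space)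
      finally show ?thesis .
    qed
  qed
  also have "\<dots> \<le> v + c * T"
  proof -
    have "semigroup_of G T V x0 = (\<integral>\<omega>. V (X T \<omega>) \<partial>M)"
      using expectation_eq_semigroup(1)[OF mp x0 T] by simp
    also have "\<dots> \<le> (\<integral>\<omega>. v \<partial>M)"
      using expectation_eq_semigroup(2)[OF mp x0 T] V(2) in_S[OF T]
      by (intro integral_mono) auto
    finally show ?thesis using V(1)[OF x0] by (simp add: prob_space)
  qed
  finally have EY: "(\<integral>\<omega>. Y \<omega> \<partial>M) \<le> v + c * T" .
  have Y_nonneg: "0 \<le> Y \<omega>" if "\<omega> \<in> space M" for \<omega>
    unfolding Y_eq using F_nonneg[OF that] by simp
  have "measure M {\<omega> \<in> space M. \<bar>Y \<omega>\<bar> > \<epsilon>} \<le> measure M {\<omega> \<in> space M. Y \<omega> \<ge> \<epsilon>}"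
    using Y_int Y_nonneg by (intro finite_measure_mono) (fastforce, simp)
  also have "\<dots> \<le> (\<integral>\<omega>. Y \<omega> \<partial>M) / \<epsilon>"
    using integral_Markov_inequality_measure[OF Y_int, of "{}" \<epsilon>] Y_nonneg eps by simp
  also have "\<dots> \<le> (v + c * T) / \<epsilon>"
    using EY eps by (simp add: divide_right_mono)
  finally show "measure M {\<omega> \<in> space M. \<bar>Y \<omega>\<bar> > \<epsilon>} \<le> (v + c * T) / \<epsilon>" .
qed

section \<open>The generator on the finite configuration space\<close>

text \<open>
  A functional that is a sum over sites changes under a jump by one term for the departure site and
  one for the arrival site. Applied to the identity this is conservation of the particle number,
  applied to the entropy below it is the drift computation.
\<close>

lemma sum_jump:
  fixes w :: "nat \<Rightarrow> real"
  assumes "finite I" "i \<in> I" "j \<in> I" "i \<noteq> j"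
  shows "(\<Sum>k\<in>I. w (jump i j \<eta> k)) =
    (\<Sum>k\<in>I. w (\<eta> k)) + (w (\<eta> i - 1) - w (\<eta> i)) + (w (\<eta> j + 1) - w (\<eta> j))"
proof -
  have "w (jump i j \<eta> k) = w (\<eta> k) + (if k = i then w (\<eta> i - 1) - w (\<eta> i) else 0)
      + (if k = j then w (\<eta> j + 1) - w (\<eta> j) else 0)" for k
    using assms(4) by (simp add: jump_def)
  then show ?thesis
    using assms by (simp add: sum.distrib)
qed

lemma jump_self: "\<eta> i > 0 \<Longrightarrow> jump i i \<eta> = \<eta>"
  by (simp add: jump_def fun_eq_iff)

lemma jump_in_Omega:
  assumes "\<eta> \<in> Omega L N" "i \<in> {1..L}" "j \<in> {1..L}" "\<eta> i > 0"
  shows "jump i j \<eta> \<in> Omega L N"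
proof (cases "i = j")
  case False
  have "real (\<Sum>k=1..L. jump i j \<eta> k) = real (\<Sum>k=1..L. \<eta> k)"
    using sum_jump[of "{1..L}" i j real \<eta>] assms False by (simp add: of_nat_diff)
  then have "(\<Sum>k=1..L. jump i j \<eta> k) = N"
    using assms(1) unfolding of_nat_eq_iff by (simp add: Omega_def)
  moreover have "jump i j \<eta> k = 0" if "k \<notin> {1..L}" for k
    using assms that by (auto simp: jump_def Omega_def)
  ultimately show ?thesis by (simp add: Omega_def)
qed (use assms in \<open>simp add: jump_self\<close>)

lemma finite_Omega: "finite (Omega L N)"
proof (rule finite_subset)
  show "Omega L N \<subseteq> {\<eta>. \<forall>i. (i \<in> {1..L} \<longrightarrow> \<eta> i \<in> {0..N}) \<and> (i \<notin> {1..L} \<longrightarrow> \<eta> i = 0)}"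
    by (auto simp: Omega_def intro: member_le_sum)
qed (intro finite_set_of_finite_funs finite_atLeastAtMost)

lemma abs_generator_le:
  assumes "\<And>k. 0 \<le> u1 k" "\<And>k. 0 \<le> u2 k" "u1 0 = 0"
    and f: "\<And>\<xi>. \<xi> \<in> Omega L N \<Longrightarrow> \<bar>f \<xi>\<bar> \<le> b" and \<eta>: "\<eta> \<in> Omega L N"
  shows "\<bar>generator L u1 u2 f \<eta>\<bar> \<le> (\<Sum>\<xi>\<in>Omega L N. \<Sum>i=1..L. \<Sum>j=1..L. u1 (\<xi> i) * u2 (\<xi> j) * 2) * b"
proof -
  have "\<bar>generator L u1 u2 f \<eta>\<bar> \<le> (\<Sum>i=1..L. \<Sum>j=1..L. \<bar>u1 (\<eta> i) * u2 (\<eta> j) * (f (jump i j \<eta>) - f \<eta>)\<bar>)"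
    unfolding generator_def by (rule order_trans[OF sum_abs sum_mono[OF sum_abs]])
  also have "\<dots> \<le> (\<Sum>i=1..L. \<Sum>j=1..L. u1 (\<eta> i) * u2 (\<eta> j) * 2 * b)"
  proof (intro sum_mono)
    fix i j assume ij: "i \<in> {1..L}" "j \<in> {1..L}"
    show "\<bar>u1 (\<eta> i) * u2 (\<eta> j) * (f (jump i j \<eta>) - f \<eta>)\<bar> \<le> u1 (\<eta> i) * u2 (\<eta> j) * 2 * b"
    proof (cases "\<eta> i = 0")
      case False
      then have "\<bar>f (jump i j \<eta>) - f \<eta>\<bar> \<le> 2 * b"
        using f[OF jump_in_Omega[OF \<eta> ij]] f[OF \<eta>] by simp
      then show ?thesis
        using mult_left_mono[of _ "2 * b" "u1 (\<eta> i) * u2 (\<eta> j)"] assms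
        by (simp add: abs_mult mult.assoc)
    qed (simp add: assms)
  qed
  also have "\<dots> = (\<Sum>i=1..L. \<Sum>j=1..L. u1 (\<eta> i) * u2 (\<eta> j) * 2) * b"
    by (simp add: sum_distrib_right)
  also have "\<dots> \<le> (\<Sum>\<xi>\<in>Omega L N. \<Sum>i=1..L. \<Sum>j=1..L. u1 (\<xi> i) * u2 (\<xi> j) * 2) * b"
    using order_trans[OF abs_ge_zero f[OF \<eta>]] assms(1,2)
    by (intro mult_right_mono member_le_sum[OF \<eta>, where f = "\<lambda>\<xi>. \<Sum>i=1..L. \<Sum>j=1..L. u1 (\<xi> i) * u2 (\<xi> j) * 2"])
      (auto intro!: sum_nonneg finite_Omega)
  finally show ?thesis .
qed

lemma bounded_generator:
  assumes "\<And>k. 0 \<le> u1 k" "\<And>k. 0 \<le> u2 k" "u1 0 = 0"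
  shows "bounded_operator_on (Omega L N) (generator L u1 u2)
    (\<Sum>\<xi>\<in>Omega L N. \<Sum>i=1..L. \<Sum>j=1..L. u1 (\<xi> i) * u2 (\<xi> j) * 2)"
proof
  show "generator L u1 u2 (\<lambda>x. f x + g x) = (\<lambda>x. generator L u1 u2 f x + generator L u1 u2 g x)" for f g
    by (simp add: generator_def fun_eq_iff algebra_simps sum.distrib sum_subtractf)
  show "generator L u1 u2 (\<lambda>x. c * f x) = (\<lambda>x. c * generator L u1 u2 f x)" for c f
    by (simp add: generator_def fun_eq_iff algebra_simps sum_distrib_left)
  show "\<bar>generator L u1 u2 f x\<bar> \<le> (\<Sum>\<xi>\<in>Omega L N. \<Sum>i=1..L. \<Sum>j=1..L. u1 (\<xi> i) * u2 (\<xi> j) * 2) * b"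
    if "\<And>x. x \<in> Omega L N \<Longrightarrow> \<bar>f x\<bar> \<le> b" "x \<in> Omega L N" for f b x
    by (rule abs_generator_le) (use assms that in auto)
qed (rule finite_Omega)

section \<open>Drift of the entropy of the fast sites\<close>

definition harm_sum :: "nat \<Rightarrow> real" where
  "harm_sum n = (\<Sum>j<n. harm j)"

text \<open>
  The total entropy of the excess particles. For product rates \<open>n\<^sub>i n\<^sub>j\<close> the weight
  \<open>harm_sum\<close>, a discrete version of \<open>n ln n\<close>, makes the drift computable: its second
  difference \<open>1 / n\<close> compensates the factor \<open>n\<close> in the rate.
\<close>

definition fast_entropy :: "nat \<Rightarrow> nat \<Rightarrow> config \<Rightarrow> real" where
  "fast_entropy A L \<eta> = (\<Sum>i=1..L. harm_sum (\<eta> i - A))"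

text \<open>
  The truncated difference takes care of slow sites: there both sides vanish since
  \<open>harm 0 = 0\<close>. In particular the creation of a fast site by a particle that arrives at a site
  with occupation \<open>A\<close> does not change the entropy.
\<close>

lemma harm_sum_incr: "harm_sum (k + 1 - A) - harm_sum (k - A) = harm (k - A)"
  by (cases "A \<le> k") (simp_all add: harm_sum_def Suc_diff_le harm_def)

lemma harm_sum_decr: "harm_sum (k - 1 - A) - harm_sum (k - A) = - harm (k - A - 1)"
proof (cases "k \<le> A")
  case False
  then show ?thesis using harm_sum_incr[of "k - 1" A] by (simp add: diff_commute)
qed (simp add: harm_sum_def harm_def)

lemma real_mult_harm_diff: "real n * (harm n - harm (n - 1)) = of_bool (n > 0)"
  by (cases n) (simp_all add: harm_Suc)

text \<open>
  The jump rate from a site with excess \<open>n\<close> to a site with excess \<open>m\<close> is replaced by the product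
  rate. Slow sites are covered with excess \<open>0\<close>: as the arrival site, the rate \<open>b\<close> is close to
  \<open>0 = m\<close> just as for fast sites. For a slow departure site the product term vanishes and the
  left-hand side is nonnegative, so that \<open>a\<close> is compared with its product form for \<open>n > 0\<close> only.
\<close>

lemma pair_drift_ge:
  fixes a b \<epsilon> B :: real and n m :: nat
  assumes "0 \<le> a" "0 \<le> b" "0 \<le> \<epsilon>"
    and a: "n > 0 \<Longrightarrow> \<bar>a - n\<bar> \<le> \<epsilon>" and b: "\<bar>b - m\<bar> \<le> \<epsilon>"
    and B: "harm m \<le> B" "harm (n - 1) \<le> B"
  shows "a * b * (harm m - harm (n - 1))
    \<ge> n * m * (harm m - harm (n - 1)) - B * (\<epsilon> * (n + m + \<epsilon>))"
proof -
  have h: "(0::real) \<le> harm m" "(0::real) \<le> harm (n - 1)" by (simp_all add: harm_nonneg)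
  show ?thesis
  proof (cases "n = 0")
    case True
    have "0 \<le> a * b * harm m" "0 \<le> B * (\<epsilon> * (m + \<epsilon>))"
      using assms h by auto
    then show ?thesis using True by (simp add: harm_def)
  next
    case False
    have "a * b - n * m = (a - n) * (b - m) + n * (b - m) + m * (a - n)"
      by (simp add: algebra_simps)
    moreover have "\<bar>(a - n) * (b - m)\<bar> \<le> \<epsilon> * \<epsilon>"
      unfolding abs_mult using a b False by (intro mult_mono) auto
    moreover have "\<bar>n * (b - m)\<bar> \<le> n * \<epsilon>" "\<bar>m * (a - n)\<bar> \<le> m * \<epsilon>"
      unfolding abs_mult using a b False by (auto intro!: mult_left_mono)
    ultimately have "\<bar>a * b - n * m\<bar> \<le> \<epsilon> * (n + m + \<epsilon>)"
      by (simp add: algebra_simps)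
    moreover have "\<bar>harm m - harm (n - 1)\<bar> \<le> B"
      using h B by linarith
    ultimately have "\<bar>(a * b - n * m) * (harm m - harm (n - 1))\<bar> \<le> (\<epsilon> * (n + m + \<epsilon>)) * B"
      unfolding abs_mult using assms by (intro mult_mono) auto
    then have "- ((\<epsilon> * (n + m + \<epsilon>)) * B) \<le> (a * b - n * m) * (harm m - harm (n - 1))"
      by linarith
    then show ?thesis by (simp add: algebra_simps)
  qed
qed

lemma sum_fast_le:
  assumes "\<eta> \<in> Omega L N"
  shows "(\<Sum>i=1..L. real (\<eta> i - A)) \<le> real N"
proof -
  have "(\<Sum>i=1..L. real (\<eta> i - A)) \<le> (\<Sum>i=1..L. real (\<eta> i))"
    by (intro sum_mono) simp
  then show ?thesis using assms by (simp add: Omega_def flip: of_nat_sum)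
qed

lemma harm_mono': "m \<le> n \<Longrightarrow> (harm m :: real) \<le> harm n"
  unfolding harm_def by (intro sum_mono2) auto

lemma occupation_le: "\<eta> \<in> Omega L N \<Longrightarrow> \<eta> i \<le> N"
  by (cases "i \<in> {1..L}") (auto simp: Omega_def intro: member_le_sum)

text \<open>
  For the product rates the sum over all pairs of sites is antisymmetric apart from the second
  differences of the weight, and equals
  \<open>(\<Sum>i. n\<^sub>i) * (\<Sum>j. n\<^sub>j * (harm n\<^sub>j - harm (n\<^sub>j - 1)))\<close>. The last factor counts the
  fast sites. The diagonal terms do not correspond to jumps and have to be taken out; they sum to
  the total excess, which is at most \<open>N\<close>.
\<close>

lemma generator_fast_entropy_ge:
  fixes \<epsilon> :: real
  assumes u: "\<And>k. 0 \<le> u1 k" "\<And>k. 0 \<le> u2 k" "u1 0 = 0" and eps: "0 \<le> \<epsilon>"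
    and u1: "\<And>k. k > A \<Longrightarrow> \<bar>u1 k - real (k - A)\<bar> \<le> \<epsilon>"
    and u2: "\<And>k. \<bar>u2 k - real (k - A)\<bar> \<le> \<epsilon>"
    and \<eta>: "\<eta> \<in> Omega L N"
  shows "generator L u1 u2 (fast_entropy A L) \<eta>
    \<ge> (real (num_fast A L \<eta>))\<^sup>2 - real N
      - harm N * ((\<epsilon> * real L) * (2 * real N + \<epsilon> * real L))"
proof -
  define n where "n i = \<eta> i - A" for i
  define B :: real where "B = harm N"
  define M where "M = (\<Sum>i=1..L. real (n i))"
  define K where "K = real (num_fast A L \<eta>)"
  have K: "K = (\<Sum>i=1..L. of_bool (n i > 0))"
    by (simp add: K_def num_fast_def n_def)
  have B0: "0 \<le> B" by (simp add: B_def harm_nonneg)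
  have MN: "M \<le> N" unfolding M_def n_def by (rule sum_fast_le[OF \<eta>])
  have KM: "K \<le> M" unfolding K M_def by (intro sum_mono) auto
  let ?d = "\<lambda>i j. (harm (n j) - harm (n i - 1) :: real)"
  let ?e = "\<lambda>i j. B * (\<epsilon> * (n i + n j + \<epsilon>))"
  have "n i * n j * ?d i j - ?e i j - (if i = j then real (n i) else 0)
      \<le> u1 (\<eta> i) * u2 (\<eta> j) * (fast_entropy A L (jump i j \<eta>) - fast_entropy A L \<eta>)"
    if "i \<in> {1..L}" "j \<in> {1..L}" for i j
  proof (cases "i = j")
    case True
    have diag: "n j * n j * ?d j j = n j"
      using real_mult_harm_diff[of "n j"] by (cases "n j = 0") (simp_all add: mult.assoc)
    have stay: "u1 (\<eta> j) * u2 (\<eta> j) * (fast_entropy A L (jump j j \<eta>) - fast_entropy A L \<eta>) = 0"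
      by (cases "\<eta> j = 0") (simp_all add: u jump_self)
    have "0 \<le> ?e j j" using B0 eps by simp
    then show ?thesis unfolding True diag stay by simp
  next
    case False
    have "fast_entropy A L (jump i j \<eta>) - fast_entropy A L \<eta> = ?d i j"
      using sum_jump[of "{1..L}" i j "\<lambda>k. harm_sum (k - A)" \<eta>] False that
        harm_sum_incr[of "\<eta> j" A] harm_sum_decr[of "\<eta> i" A]
      by (simp add: fast_entropy_def n_def)
    moreover have "n i * n j * ?d i j - ?e i j \<le> u1 (\<eta> i) * u2 (\<eta> j) * ?d i j"
    proof (rule pair_drift_ge)
      show "harm (n j) \<le> B" "harm (n i - 1) \<le> B"
        using occupation_le[OF \<eta>, of j] occupation_le[OF \<eta>, of i]
        unfolding B_def n_def by (intro harm_mono'; linarith)+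
    qed (use u eps u1[of "\<eta> i"] u2[of "\<eta> j"] in \<open>simp_all add: n_def\<close>)
    ultimately show ?thesis using False by simp
  qed
  then have "(\<Sum>i=1..L. \<Sum>j=1..L. n i * n j * ?d i j - ?e i j - (if i = j then real (n i) else 0))
      \<le> generator L u1 u2 (fast_entropy A L) \<eta>"
    unfolding generator_def by (intro sum_mono) auto
  moreover have "(\<Sum>i=1..L. \<Sum>j=1..L. n i * n j * ?d i j - ?e i j - (if i = j then real (n i) else 0))
      = M * K - B * ((\<epsilon> * L) * (2 * M + \<epsilon> * L)) - M"
  proof -
    have "(\<Sum>i=1..L. \<Sum>j=1..L. n i * n j * ?d i j)
        = M * (\<Sum>j=1..L. n j * harm (n j)) - (\<Sum>i=1..L. n i * harm (n i - 1)) * M"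
      unfolding M_def sum_product
      by (simp add: algebra_simps sum_subtractf)
    also have "\<dots> = M * (\<Sum>j=1..L. n j * (harm (n j) - harm (n j - 1)))"
      by (simp add: algebra_simps sum_subtractf)
    also have "\<dots> = M * K"
      by (simp only: real_mult_harm_diff K)
    finally have 1: "(\<Sum>i=1..L. \<Sum>j=1..L. n i * n j * ?d i j) = M * K" .
    have 2: "(\<Sum>i=1..L. \<Sum>j=1..L. ?e i j) = B * ((\<epsilon> * L) * (2 * M + \<epsilon> * L))"
      by (simp add: M_def sum.distrib algebra_simps sum_distrib_left[symmetric])
    have 3: "(\<Sum>i=1..L. \<Sum>j=1..L. if i = j then real (n i) else 0) = M"
      by (simp add: M_def)
    show ?thesis by (simp only: sum_subtractf 1 2 3)
  qed
  moreover have "K\<^sup>2 \<le> M * K"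
    using KM by (simp add: power2_eq_square mult_right_mono K_def)
  moreover have "B * ((\<epsilon> * L) * (2 * M + \<epsilon> * L)) \<le> B * ((\<epsilon> * L) * (2 * real N + \<epsilon> * L))"
    using B0 eps MN by (intro mult_left_mono) auto
  ultimately show ?thesis using MN unfolding K_def B_def by linarith
qed

lemma fast_entropy_nonneg: "0 \<le> fast_entropy A L \<eta>"
  by (simp add: fast_entropy_def harm_sum_def sum_nonneg harm_nonneg)

lemma fast_entropy_le:
  assumes "\<eta> \<in> Omega L N"
  shows "fast_entropy A L \<eta> \<le> N * harm N"
proof -
  have "fast_entropy A L \<eta> \<le> (\<Sum>i=1..L. real (\<eta> i - A) * harm N)"
    unfolding fast_entropy_def
  proof (rule sum_mono)
    fix i
    have "harm_sum (\<eta> i - A) \<le> (\<Sum>j<\<eta> i - A. harm N)"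
      unfolding harm_sum_def using occupation_le[OF assms, of i]
      by (intro sum_mono harm_mono') auto
    then show "harm_sum (\<eta> i - A) \<le> real (\<eta> i - A) * harm N" by simp
  qed
  also have "\<dots> \<le> N * harm N"
    unfolding sum_distrib_right[symmetric]
    by (intro mult_right_mono sum_fast_le[OF assms] harm_nonneg)
  finally show ?thesis .
qed

text \<open>
  The occupation time bound is applied with a multiple of the entropy, the multiple being chosen so
  that the quadratic gain \<open>K\<^sup>2\<close> in its drift becomes the term \<open>(K / L)\<^sup>2 / (4 a)\<close> in
  \<open>K / L \<le> a + (K / L)\<^sup>2 / (4 a)\<close>.
\<close>

lemma fast_fraction_occupation_bound:
  fixes L N :: nat and \<epsilon> a \<delta> T :: real
  assumes u: "\<And>k. 0 \<le> u1 k" "\<And>k. 0 \<le> u2 k" "u1 0 = 0" and eps: "0 \<le> \<epsilon>"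
    and u1: "\<And>k. k > A \<Longrightarrow> \<bar>u1 k - real (k - A)\<bar> \<le> \<epsilon>"
    and u2: "\<And>k. \<bar>u2 k - real (k - A)\<bar> \<le> \<epsilon>"
    and mp: "markov_process_started M (Omega L N) (generator L u1 u2) \<eta>0 X"
    and \<eta>0: "\<eta>0 \<in> Omega L N" and L: "L \<ge> 1" and T: "0 \<le> T" and a: "0 < a" and \<delta>: "0 < \<delta>"
  defines "Y \<equiv> (\<lambda>\<omega>. LINT t:{0..T}|lborel. real (num_fast A L (X t \<omega>)) / real L)"
  shows "Y \<in> borel_measurable M"
    and "measure M {\<omega> \<in> space M. \<bar>Y \<omega>\<bar> > \<delta>} \<le>
      (real N * harm N / (4 * a * (real L)\<^sup>2)
        + (a + (real N + harm N * ((\<epsilon> * real L) * (2 * real N + \<epsilon> * real L)))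
            / (4 * a * (real L)\<^sup>2)) * T) / \<delta>"
proof -
  interpret bounded_operator_on "Omega L N" "generator L u1 u2"
    "\<Sum>\<xi>\<in>Omega L N. \<Sum>i=1..L. \<Sum>j=1..L. u1 (\<xi> i) * u2 (\<xi> j) * 2"
    by (rule bounded_generator) (use u in auto)
  define Q where "Q = real N + harm N * ((\<epsilon> * real L) * (2 * real N + \<epsilon> * real L))"
  define s where "s = 4 * a * (real L)\<^sup>2"
  have s: "0 < s" using a L by (simp add: s_def)
  define V where "V = (\<lambda>\<eta>. (1 / s) * fast_entropy A L \<eta>)"
  have drift: "real (num_fast A L \<eta>) / real L \<le> generator L u1 u2 V \<eta> + (a + Q / s)"
    if \<eta>: "\<eta> \<in> Omega L N" for \<eta>
  proof -
    define k where "k = real (num_fast A L \<eta>) / real L"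
    \<comment> \<open>arithmetic-geometric mean inequality\<close>
    have "0 \<le> (k - 2 * a)\<^sup>2" by simp
    then have "k \<le> a + k\<^sup>2 / (4 * a)"
      using a by (simp add: field_simps power2_eq_square)
    also have "k\<^sup>2 / (4 * a) = (real (num_fast A L \<eta>))\<^sup>2 / s"
      by (simp add: k_def s_def power_divide)
    also have "\<dots> \<le> (generator L u1 u2 (fast_entropy A L) \<eta> + Q) / s"
      using generator_fast_entropy_ge[OF u eps u1 u2 \<eta>] s
      by (intro divide_right_mono) (auto simp: Q_def)
    also have "\<dots> = generator L u1 u2 V \<eta> + Q / s"
      unfolding V_def scale by (simp add: add_divide_distrib)
    finally show ?thesis by (simp add: k_def)
  qed
  have V: "0 \<le> V \<eta>" for \<eta> using s by (simp add: V_def fast_entropy_nonneg)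
  have V_le: "V \<eta> \<le> N * harm N / s" if "\<eta> \<in> Omega L N" for \<eta>
    using fast_entropy_le[OF that, of A] s by (simp add: V_def divide_right_mono)
  note * = occupation_time_bound[OF mp \<eta>0 T, of "\<lambda>\<eta>. real (num_fast A L \<eta>) / real L",
    OF _ drift V V_le \<delta>]
  show "Y \<in> borel_measurable M"
    unfolding Y_def by (rule *(1)) simp_all
  have "measure M {\<omega> \<in> space M. \<bar>Y \<omega>\<bar> > \<delta>} \<le> (N * harm N / s + (a + Q / s) * T) / \<delta>"
    unfolding Y_def by (rule *(2)) simp_all
  then show "measure M {\<omega> \<in> space M. \<bar>Y \<omega>\<bar> > \<delta>} \<le>
      (real N * harm N / (4 * a * (real L)\<^sup>2)
        + (a + (real N + harm N * ((\<epsilon> * real L) * (2 * real N + \<epsilon> * real L)))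
            / (4 * a * (real L)\<^sup>2)) * T) / \<delta>"
    by (simp add: Q_def s_def)
qed

section \<open>Thermodynamic limit\<close>

text \<open>
  Slow and fast rates are brought to a common form: \<open>u2 L k\<close> is of order \<open>1 / L\<close> for
  \<open>k \<le> A\<close>, so that it too lies within \<open>D / L\<close> of the truncated difference \<open>k - A = 0\<close>.
\<close>

lemma rate_bounds:
  assumes "rate_assumptions u1 u2 A q r \<zeta>"
  shows "\<exists>D>0. eventually (\<lambda>L. \<forall>k. (k > A \<longrightarrow> \<bar>u1 L k - real (k - A)\<bar> \<le> D / real L) \<and>
    \<bar>u2 L k - real (k - A)\<bar> \<le> D / real L) at_top"
proof -
  have nonneg: "0 \<le> u2 L k" if "L \<ge> 1" for L k
    using assms that by (simp add: rate_assumptions_def)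
  have slow: "\<bar>u2 L k * real L - r k\<bar> \<le> \<zeta> L" if "L \<ge> 1" "k \<le> A" for L k
    using assms that by (simp add: rate_assumptions_def)
  have fast: "\<bar>u1 L k - (real k - real A)\<bar> \<le> \<zeta> L" "\<bar>u2 L k - (real k - real A)\<bar> \<le> \<zeta> L"
    if "L \<ge> 1" "k > A" for L k
    using assms that by (simp_all add: rate_assumptions_def)
  have r: "0 \<le> r k" if "k \<le> A" for k
  proof (cases "k = 0")
    case True
    then show ?thesis using assms by (simp add: rate_assumptions_def)
  next
    case False
    then have "q k \<le> r k \<and> 0 < q k" using assms that by (simp add: rate_assumptions_def)
    then show ?thesis by linarith
  qed
  have "\<zeta> \<in> O(\<lambda>L. 1 / real L)" using assms by (simp add: rate_assumptions_def)
  then obtain z where z: "z > 0" "eventually (\<lambda>L. norm (\<zeta> L) \<le> z * norm (1 / real L)) at_top"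
    by (rule landau_o.bigE)
  (* a slow rate u2 L k lies within \<zeta> L / L of r k / L, and \<zeta> L \<le> z *)
  define D where "D = z + (\<Sum>k\<le>A. r k)"
  have rD: "r k + z \<le> D" if "k \<le> A" for k
    unfolding D_def using member_le_sum[of k "{..A}" r] that r by auto
  have zD: "z \<le> D" using r by (auto simp: D_def intro!: sum_nonneg)
  have "eventually (\<lambda>L. \<forall>k. (k > A \<longrightarrow> \<bar>u1 L k - real (k - A)\<bar> \<le> D / real L) \<and>
    \<bar>u2 L k - real (k - A)\<bar> \<le> D / real L) at_top"
    using z(2) eventually_ge_at_top[of 1]
  proof eventually_elim
    case (elim L)
    then have \<zeta>: "\<zeta> L \<le> z / L" by simp
    have "z / L \<le> z" using elim z(1) by (simp add: field_simps)
    have "z / L \<le> D / L" using zD by (simp add: divide_right_mono)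
    show ?case
    proof (intro allI conjI impI)
      fix k
      show "\<bar>u1 L k - real (k - A)\<bar> \<le> D / real L" if "k > A"
        using fast(1)[OF elim(2) that] \<zeta> \<open>z / L \<le> D / L\<close> that by (simp add: of_nat_diff)
      show "\<bar>u2 L k - real (k - A)\<bar> \<le> D / real L"
      proof (cases "k > A")
        case True
        then show ?thesis
          using fast(2)[OF elim(2) True] \<zeta> \<open>z / L \<le> D / L\<close> by (simp add: of_nat_diff)
      next
        case False
        then have "u2 L k * L \<le> D"
          using slow[OF elim(2), of k] rD[of k] \<zeta> \<open>z / L \<le> z\<close> by simp
        then show ?thesis
          using elim(2) nonneg[OF elim(2), of k] False by (simp add: pos_le_divide_eq)
      qed
    qed
  qed
  then show ?thesis using zD z(1) by (intro exI[of _ D]) auto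
qed

lemma filterlim_fst_thermodynamic: "filterlim fst at_top (thermodynamic \<rho>)"
  and filterlim_snd_thermodynamic: "filterlim snd at_top (thermodynamic \<rho>)"
  unfolding thermodynamic_def
  by (rule filterlim_mono[OF filterlim_fst order_refl inf_le1]
           filterlim_mono[OF filterlim_snd order_refl inf_le1])+

lemma eventually_density_less:
  assumes "\<rho> < c"
  shows "eventually (\<lambda>(L, N). real N / real L < c) (thermodynamic \<rho>)"
proof -
  have "eventually (\<lambda>x. x < c) (nhds \<rho>)"
    using assms by (intro order_tendstoD(2)[of "\<lambda>x. x"]) (simp_all add: filterlim_ident)
  then have "eventually (\<lambda>p. (case p of (L, N) \<Rightarrow> real N / real L) < c)
      (filtercomap (\<lambda>(L, N). real N / real L) (nhds \<rho>))"
    by (rule eventually_filtercomapI)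
  then show ?thesis
    unfolding thermodynamic_def by (auto simp: case_prod_beta' intro: filter_leD[OF inf_le2])
qed

theorem proposition4p2:
  fixes \<rho> T :: real
    and A :: nat
    and u1 u2 :: "nat \<Rightarrow> nat \<Rightarrow> real"
    and q r \<zeta> :: "nat \<Rightarrow> real"
    and M :: "nat \<Rightarrow> nat \<Rightarrow> 'a measure"
    and X :: "nat \<Rightarrow> nat \<Rightarrow> real \<Rightarrow> 'a \<Rightarrow> config"
    and \<eta>0 :: "nat \<Rightarrow> nat \<Rightarrow> config"
  assumes "\<rho> > 0"
    and "rate_assumptions u1 u2 A q r \<zeta>"
    and "\<And>L N. L \<ge> 1 \<Longrightarrow> N \<ge> 1 \<Longrightarrow> \<eta>0 L N \<in> Omega L N"
    and "\<And>L N. L \<ge> 1 \<Longrightarrow> N \<ge> 1 \<Longrightarrow>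
      markov_process_started (M L N) (Omega L N) (generator L (u1 L) (u2 L)) (\<eta>0 L N) (X L N)"
    and "\<exists>g\<in>{0..1}. ((\<lambda>(L, N). fast_mass A L N (\<eta>0 L N)) \<longlongrightarrow> g) (thermodynamic \<rho>)"
    and "T > 0"
  shows "tendsto_in_prob (\<lambda>(L, N). M L N)
      (\<lambda>(L, N) \<omega>. LINT t:{0..T}|lborel. real (num_fast A L (X L N t \<omega>)) / real L)
      0 (thermodynamic \<rho>)"
proof -
  define c where "c = \<rho> + 1"
  have c: "c > 0" using assms(1) by (simp add: c_def)
  obtain D where D: "D > 0" and rates: "eventually (\<lambda>L. \<forall>k.
      (k > A \<longrightarrow> \<bar>u1 L k - real (k - A)\<bar> \<le> D / real L) \<and> \<bar>u2 L k - real (k - A)\<bar> \<le> D / real L) at_top"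
    using rate_bounds[OF assms(2)] by blast
  have u: "0 \<le> u1 L k" "0 \<le> u2 L k" "u1 L 0 = 0" if "L \<ge> 1" for L k
    using assms(2) that by (simp_all add: rate_assumptions_def)
  define Y where "Y = (\<lambda>L N \<omega>. LINT t:{0..T}|lborel. real (num_fast A L (X L N t \<omega>)) / real L)"
  (* The bound of fast_fraction_occupation_bound with N replaced by c * L, harm N by
     ln (c * L) + 1, and a = L powr (-1/4). This a tends to 0, but more slowly than ln L / L,
     so that both a and ln L / (a * L) vanish. *)
  define bd where "bd L = (c * L * (ln (c * L) + 1) / (4 * L powr (-1/4) * L\<^sup>2)
      + (L powr (-1/4) + (c * L + (ln (c * L) + 1) * (D * (2 * (c * L) + D))) / (4 * L powr (-1/4) * L\<^sup>2)) * T)"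
    for L :: real
  have good: "eventually (\<lambda>(L, N). L \<ge> 1 \<and> N \<ge> 1 \<and> real N \<le> c * real L \<and>
      (\<forall>k. (k > A \<longrightarrow> \<bar>u1 L k - real (k - A)\<bar> \<le> D / real L) \<and> \<bar>u2 L k - real (k - A)\<bar> \<le> D / real L))
      (thermodynamic \<rho>)"
    using eventually_compose_filterlim[OF rates filterlim_fst_thermodynamic]
      eventually_compose_filterlim[OF eventually_ge_at_top[of 1] filterlim_fst_thermodynamic]
      eventually_compose_filterlim[OF eventually_ge_at_top[of 1] filterlim_snd_thermodynamic]
      eventually_density_less[of \<rho> c, unfolded c_def, OF less_add_one]
  proof eventually_elim
    case (elim p)
    then have "real (snd p) < c * real (fst p)"
      by (simp add: case_prod_beta' c_def pos_divide_less_eq)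
    then show ?case using elim(1-3) by (simp add: case_prod_beta' less_imp_le)
  qed
  have estimate: "Y L N \<in> borel_measurable (M L N)"
      "\<delta> > 0 \<Longrightarrow> measure (M L N) {\<omega> \<in> space (M L N). \<bar>Y L N \<omega>\<bar> > \<delta>} \<le> bd L / \<delta>"
    if L: "L \<ge> 1" and N: "N \<ge> 1" and NL: "real N \<le> c * real L"
      and rates: "\<And>k. k > A \<Longrightarrow> \<bar>u1 L k - real (k - A)\<bar> \<le> D / real L"
        "\<And>k. \<bar>u2 L k - real (k - A)\<bar> \<le> D / real L" for L N \<delta>
  proof -
    define a where "a = real L powr (-1/4)"
    have a: "a > 0" using L by (simp add: a_def)
    note * = fast_fraction_occupation_bound[where ?u1.0 = "u1 L" and ?u2.0 = "u2 L" and A = A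
        and \<epsilon> = "D / real L",
        OF u(1)[OF L] u(2)[OF L] u(3)[OF L] _ rates assms(4)[OF L N] assms(3)[OF L N] L less_imp_le[OF assms(6)] a]
    show "Y L N \<in> borel_measurable (M L N)"
      unfolding Y_def by (rule *(1)[of 1]) (use D in simp_all)
    assume \<delta>: "\<delta> > 0"
    define h where "h = ln (c * L) + 1"
    have "harm N \<le> ln (real N) + (1::real)"
      using decseqD[OF decseq_harm_diff_ln, of 0 "N - 1"] N by (simp add: harm_def)
    also have "\<dots> \<le> h" unfolding h_def using N NL by simp
    finally have h: "harm N \<le> h" .
    have h0: "0 \<le> (harm N :: real)" by (rule harm_nonneg)
    have "measure (M L N) {\<omega> \<in> space (M L N). \<bar>Y L N \<omega>\<bar> > \<delta>} \<le>
      (real N * harm N / (4 * a * (real L)\<^sup>2)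
        + (a + (real N + harm N * (D * (2 * real N + D))) / (4 * a * (real L)\<^sup>2)) * T) / \<delta>"
      unfolding Y_def using *(2)[OF _ _ \<delta>] D L by simp
    also have "\<dots> \<le> (c * real L * h / (4 * a * (real L)\<^sup>2)
        + (a + (c * real L + h * (D * (2 * (c * real L) + D))) / (4 * a * (real L)\<^sup>2)) * T) / \<delta>"
    proof -
      have "0 \<le> h" using h h0 by linarith
      have "real N * harm N \<le> c * real L * h"
        using NL h h0 c by (intro mult_mono) auto
      moreover have "harm N * (D * (2 * real N + D)) \<le> h * (D * (2 * (c * real L) + D))"
        using NL h D \<open>0 \<le> h\<close> by (intro mult_mono mult_left_mono add_right_mono) auto
      ultimately show ?thesis
        using NL a \<delta> assms(6)
        by (intro divide_right_mono add_mono mult_right_mono order_refl) simp_all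
    qed
    finally show "measure (M L N) {\<omega> \<in> space (M L N). \<bar>Y L N \<omega>\<bar> > \<delta>} \<le> bd L / \<delta>"
      by (simp add: bd_def a_def h_def)
  qed
  have "((\<lambda>L. bd (real L)) \<longlongrightarrow> 0) at_top"
    unfolding bd_def using c D assms(6) by real_asymp
  from filterlim_compose[OF this filterlim_fst_thermodynamic]
  have bd: "((\<lambda>p. bd (real (fst p))) \<longlongrightarrow> 0) (thermodynamic \<rho>)" .
  show ?thesis
    unfolding tendsto_in_prob_def case_prod_beta'
  proof (intro conjI allI impI)
    show "\<forall>\<^sub>F p in thermodynamic \<rho>. (\<lambda>\<omega>. LINT t:{0..T}|lborel. real (num_fast A (fst p) (X (fst p) (snd p) t \<omega>)) / real (fst p))
        \<in> borel_measurable (M (fst p) (snd p))"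
      using good by eventually_elim (use estimate(1) in \<open>auto simp: Y_def\<close>)
    fix \<delta> :: real assume \<delta>: "\<delta> > 0"
    have "((\<lambda>p. measure (M (fst p) (snd p)) {\<omega> \<in> space (M (fst p) (snd p)). \<bar>Y (fst p) (snd p) \<omega>\<bar> > \<delta>}) \<longlongrightarrow> 0)
        (thermodynamic \<rho>)"
    proof (rule tendsto_sandwich)
      show "((\<lambda>p. 0) \<longlongrightarrow> (0::real)) (thermodynamic \<rho>)" by simp
      show "((\<lambda>p. bd (real (fst p)) / \<delta>) \<longlongrightarrow> 0) (thermodynamic \<rho>)"
        using tendsto_divide[OF bd tendsto_const, of \<delta>] \<delta> by simp
      show "\<forall>\<^sub>F p in thermodynamic \<rho>. measure (M (fst p) (snd p))
          {\<omega> \<in> space (M (fst p) (snd p)). \<bar>Y (fst p) (snd p) \<omega>\<bar> > \<delta>} \<le> bd (real (fst p)) / \<delta>"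
        using good by eventually_elim (use estimate(2)[OF _ _ _ _ _ \<delta>] in auto)
    qed simp
    then show "((\<lambda>p. measure (M (fst p) (snd p)) {\<omega> \<in> space (M (fst p) (snd p)).
        \<bar>(LINT t:{0..T}|lborel. real (num_fast A (fst p) (X (fst p) (snd p) t \<omega>)) / real (fst p)) - 0\<bar> > \<delta>}) \<longlongrightarrow> 0)
        (thermodynamic \<rho>)"
      by (simp add: Y_def)
  qed
qed

end
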